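(* Let $d\geqslant 1$ be an integer and let $A=\{\boldsymbol{x}_n\}_{n=1}^\infty\subseteq\mathbb{R}^d$ be a sequence of non-zero vectors. If \[ \lim_{n\to\infty}\|\boldsymbol{x}_n\|=0\quad\text{and}\quad \lim_{n\to\infty}\frac{\|\boldsymbol{x}_{n+1}\|}{\|\boldsymbol{x}_n\|}=1, \] then there exists a closed set $E\subseteq[0,1]^d$ with $\mu(E)>0$ such that $E$ contains no affine copies of $A$.
   Context: $\|\cdot\|$ is the Euclidean norm on $\mathbb{R}^d$ and $\mu$ is $d$-dimensional Lebesgue measure. $\mathrm{GL}_d(\mathbb{R})$ is the set of invertible $d\times d$ real matrices. An affine copy of a set $A\subseteq\mathbb{R}^d$ is a set of the form $TA+\boldsymbol{x}=\{T\boldsymbol{a}+\boldsymbol{x}:\boldsymbol{a}\in A\}$ with $T\in\mathrm{GL}_d(\mathbb{R})$ and $\boldsymbol{x}\in\mathbb{R}^d$. "$E$ contains no affine copies of $A$" means $TA+\boldsymbol{x}\not\subseteq E$ for all $T\in\mathrm{GL}_d(\mathbb{R})$ and all $\boldsymbol{x}\in\mathbb{R}^d$. *)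

theory Defs
  imports "HOL-Analysis.Analysis"
begin

definition affine_copy :: "(real^'d) set \<Rightarrow> (real^'d) set \<Rightarrow> bool" where
  "affine_copy A B \<longleftrightarrow>
     (\<exists>(T :: real^'d^'d) v. invertible T \<and> B = (\<lambda>a. T *v a + v) ` A)"

definition contains_no_affine_copies :: "(real^'d) set \<Rightarrow> (real^'d) set \<Rightarrow> bool" where
  "contains_no_affine_copies E A \<longleftrightarrow> (\<forall>B. affine_copy A B \<longrightarrow> \<not> B \<subseteq> E)"

lemma contains_no_affine_copies_iff:
  "contains_no_affine_copies E A \<longleftrightarrow>
     (\<forall>(T :: real^'d^'d) v. invertible T \<longrightarrow> \<not> (\<lambda>a. T *v a + v) ` A \<subseteq> E)"
  unfolding contains_no_affine_copies_def affine_copy_def by blast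

text \<open>The vector \<open>1\<close> is the all-ones vector, so \<open>cbox 0 1\<close> is the closed unit cube.\<close>

lemma unit_cube_eq: "cbox 0 (1 :: real^'d) = {x. \<forall>i. 0 \<le> x $ i \<and> x $ i \<le> 1}"
  by (auto simp: mem_box_cart)

end

theory Submission
  imports Defs
begin

text \<open>
  Since the ratios of consecutive norms tend to \<open>1\<close>, for every \<open>K\<close> the sequence contains, at
  arbitrarily small scales \<open>r\<close>, \<open>K\<close> points of norm at most \<open>r\<close> that are pairwise at distance at
  least \<open>r / (2 K)\<close>. Fix \<open>k\<close> and consider the pairs \<open>(T, v)\<close> where \<open>T\<close> distorts lengths by a factor
  at most \<open>k\<close>. Subdivide the cube into a grid of mesh \<open>s\<close> comparable to \<open>r / K\<close>, and reduce cell
  indices modulo \<open>N\<close> comparable to \<open>K\<close>. Up to rounding errors below the mesh, such pairs give only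
  polynomially many (in \<open>K\<close>) sets of cells, each consisting of \<open>K\<close> distinct ones among the \<open>N ^ d\<close>
  cells of the torus. A greedy choice hits all of them with a proportion of about \<open>log K / K\<close> of the
  cells, which is as small as we like. Removing from the cube slight enlargements of the chosen
  cells, with total measure less than \<open>1\<close> over all \<open>k\<close>, leaves the required set.
\<close>

section \<open>Greedy hitting sets of finite families\<close>

text \<open>Double counting of incidences gives a point of \<open>X\<close> in at least a fraction
  \<open>K / card X\<close> of the sets. Choosing it shrinks the family still to be hit by the
  factor \<open>1 - K / card X\<close> or better; after \<open>t\<close> rounds fewer than one set,
  hence none, is left.\<close>

lemma small_hitting_set:
  fixes F :: "'a set set"
  assumes "finite X" "X \<noteq> {}" "finite F"
    and "\<And>S. S \<in> F \<Longrightarrow> S \<subseteq> X" "\<And>S. S \<in> F \<Longrightarrow> K \<le> card S"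
    and "K \<le> card X"
    and "real (card F) * (1 - real K / real (card X)) ^ t < 1"
  shows "\<exists>H\<subseteq>X. card H \<le> t \<and> (\<forall>S\<in>F. S \<inter> H \<noteq> {})"
  using assms
proof (induction t arbitrary: F)
  case 0
  then have "F = {}" by simp
  then show ?case by (intro exI[of _ "{}"]) auto
next
  case (Suc t)
  define q where "q = real K / real (card X)"
  have X0: "card X > 0" using Suc.prems by (simp add: card_gt_0_iff)
  have q: "0 \<le> q" "q \<le> 1" using Suc.prems(6) X0 by (auto simp: q_def field_simps)
  have "\<exists>x\<in>X. real (card {S \<in> F. x \<in> S}) \<ge> q * real (card F)"
  proof (rule ccontr)
    assume "\<not> ?thesis"
    then have "(\<Sum>x\<in>X. real (card {S \<in> F. x \<in> S})) < (\<Sum>x\<in>X. q * real (card F))"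
      using Suc.prems(1,2) by (intro sum_strict_mono) (auto simp: not_le)
    also have "\<dots> = real (K * card F)" using X0 by (simp add: q_def)
    also have "\<dots> = real (\<Sum>S\<in>F. K)" by simp
    also have "\<dots> \<le> real (\<Sum>S\<in>F. card S)" 
      using Suc.prems(5) by (intro of_nat_mono sum_mono) auto
    also have "(\<Sum>S\<in>F. card S) = (\<Sum>S\<in>F. card {x\<in>X. x \<in> S})"
      using Suc.prems(4) by (intro sum.cong refl arg_cong[where f=card]) auto
    also have "\<dots> = (\<Sum>x\<in>X. card {S \<in> F. x \<in> S})"
      using sum.swap_restrict[OF \<open>finite F\<close> \<open>finite X\<close>, where g="\<lambda>_ _. 1::nat" and R="\<lambda>S x. x \<in> S"]
      by simp
    finally show False by simp
  qed
  then obtain x where x: "x \<in> X" "real (card {S \<in> F. x \<in> S}) \<ge> q * real (card F)" by blast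
  define F' where "F' = {S \<in> F. x \<notin> S}"
  have "card F = card {S \<in> F. x \<in> S} + card F'"
    using Suc.prems(3) unfolding F'_def
    by (subst card_Un_disjoint[symmetric]) (auto intro: arg_cong[where f=card])
  then have "real (card F') \<le> real (card F) * (1 - q)" using x by (simp add: algebra_simps)
  then have "real (card F') * (1 - q) ^ t \<le> real (card F) * (1 - q) * (1 - q) ^ t"
    using q by (intro mult_right_mono) auto
  also have "\<dots> < 1" using Suc.prems(7) by (simp add: q_def mult.assoc)
  finally have lt: "real (card F') * (1 - q) ^ t < 1" .
  have "\<exists>H\<subseteq>X. card H \<le> t \<and> (\<forall>S\<in>F'. S \<inter> H \<noteq> {})"
    by (rule Suc.IH) (use Suc.prems lt in \<open>auto simp: F'_def q_def\<close>)
  then obtain H where H: "H \<subseteq> X" "card H \<le> t" "\<forall>S\<in>F'. S \<inter> H \<noteq> {}" by blast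
  have "card (insert x H) \<le> Suc t"
    using H(2) card_insert_le_m1[of "Suc t" H x] by simp
  moreover have "\<forall>S\<in>F. S \<inter> insert x H \<noteq> {}" using H(3) by (auto simp: F'_def)
  moreover have "insert x H \<subseteq> X" using x(1) H(1) by simp
  ultimately show ?case by (intro exI[of _ "insert x H"] conjI)
qed

section \<open>Well-separated points at small scales\<close>

text \<open>The norms alone separate the points: they are picked close to equally spaced levels
  between \<open>0\<close> and \<open>r\<close>, and the ratio hypothesis keeps the sequence from
  jumping far past a level on its way to \<open>0\<close>.\<close>

lemma separated_norms:
  fixes x :: "nat \<Rightarrow> 'a::real_normed_vector"
  assumes nz: "\<And>n. x n \<noteq> 0"
    and lim0: "(\<lambda>n. norm (x n)) \<longlonglongrightarrow> 0"
    and ratio: "(\<lambda>n. norm (x (Suc n)) / norm (x n)) \<longlonglongrightarrow> 1"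
    and K: "K \<ge> 1" and rho: "\<rho> > 0"
  obtains r p where "0 < r" "r \<le> \<rho>" "\<And>j. j < K \<Longrightarrow> p j \<in> range x"
    "\<And>j. j < K \<Longrightarrow> norm (p j) \<le> r"
    "\<And>i j. i < K \<Longrightarrow> j < K \<Longrightarrow> i \<noteq> j \<Longrightarrow> r / (2 * real K) \<le> norm (p i - p j)"
proof -
  \<comment> \<open>Falling short of a level by at most \<open>\<eta> * r\<close> uses up half of
    the spacing \<open>r / K\<close>; the other half remains as separation.\<close>
  define \<eta> where "\<eta> = 1 / (2 * real K)"
  have eta: "\<eta> > 0" "\<eta> < 1" using K by (auto simp: \<eta>_def)
  have "\<forall>\<^sub>F n in sequentially. norm (x (Suc n)) / norm (x n) > 1 - \<eta>"
    using ratio eta by (intro order_tendstoD) auto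
  moreover have "\<forall>\<^sub>F n in sequentially. norm (x n) < \<rho>"
    using lim0 rho by (intro order_tendstoD) auto
  ultimately have "\<forall>\<^sub>F n in sequentially. norm (x (Suc n)) / norm (x n) > 1 - \<eta> \<and> norm (x n) < \<rho>"
    by eventually_elim auto
  then obtain n0 where "\<forall>n\<ge>n0. norm (x (Suc n)) / norm (x n) > 1 - \<eta> \<and> norm (x n) < \<rho>"
    unfolding eventually_sequentially by blast
  then have n0: "\<And>n. n \<ge> n0 \<Longrightarrow> norm (x (Suc n)) / norm (x n) > 1 - \<eta>" "norm (x n0) < \<rho>"
    by simp_all
  define r where "r = norm (x n0)"
  have r: "r > 0" using nz by (simp add: r_def)
  have step: "norm (x (Suc n)) \<ge> (1 - \<eta>) * norm (x n)" if "n \<ge> n0" for n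
    using n0(1)[OF that] nz[of n] by (simp add: field_simps)
  define l where "l j = r * real (Suc j) / real K" for j
  have l0: "l j > 0" for j using r K by (simp add: l_def)
  have lK: "l j \<le> r" if "j < K" for j
  proof -
    have "r * real (Suc j) \<le> r * real K" using that r by (intro mult_left_mono) auto
    then show ?thesis using K by (simp add: l_def pos_divide_le_eq)
  qed
  have "\<exists>n\<ge>n0. (1 - \<eta>) * l j \<le> norm (x n) \<and> norm (x n) \<le> l j" if j: "j < K" for j
  proof -
    have "\<forall>\<^sub>F n in sequentially. norm (x n) < l j"
      using lim0 l0 by (intro order_tendstoD) auto
    then obtain n1 where "n1 \<ge> n0" "norm (x n1) \<le> l j"
      unfolding eventually_sequentially by (metis less_imp_le max.cobounded1 max.cobounded2)
    then have ex: "\<exists>n. n \<ge> n0 \<and> norm (x n) \<le> l j" by blast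
    \<comment> \<open>Unless this first index is \<open>n0\<close>, the preceding norm still exceeds
      \<open>l j\<close>, so a single step loses at most the factor
      \<open>1 - \<eta>\<close>.\<close>
    define n where "n = (LEAST n. n \<ge> n0 \<and> norm (x n) \<le> l j)"
    have n: "n \<ge> n0" "norm (x n) \<le> l j" using LeastI_ex[OF ex] by (auto simp: n_def)
    have "(1 - \<eta>) * l j \<le> norm (x n)"
    proof (cases "n = n0")
      case True
      have "l j \<le> r" by (rule lK[OF j])
      moreover have "(1 - \<eta>) * l j \<le> l j" using eta l0[of j] by (simp add: algebra_simps)
      ultimately show ?thesis using True by (simp add: r_def)
    next
      case False
      then obtain n' where n': "n = Suc n'" "n' \<ge> n0" using n(1) by (cases n) auto
      have "\<not> (n' \<ge> n0 \<and> norm (x n') \<le> l j)"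
        using not_less_Least[of n' "\<lambda>n. n \<ge> n0 \<and> norm (x n) \<le> l j"] n' by (auto simp: n_def)
      then have "(1 - \<eta>) * l j \<le> (1 - \<eta>) * norm (x n')"
        using n' eta by (intro mult_left_mono) auto
      then show ?thesis using step[OF n'(2)] n' by simp
    qed
    then show ?thesis using n by blast
  qed
  then obtain N where N: "\<And>j. j < K \<Longrightarrow> (1 - \<eta>) * l j \<le> norm (x (N j)) \<and> norm (x (N j)) \<le> l j"
    by metis
  have sep: "r * \<eta> \<le> norm (x (N i) - x (N j))" if "i < K" "j < i" for i j
  proof -
    have "l j + 2 * r * \<eta> = r * (real (Suc j) + 1) / K" using K by (simp add: l_def \<eta>_def field_simps)
    also have "\<dots> \<le> l i" unfolding l_def using that r K
      by (intro divide_right_mono mult_left_mono) auto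
    finally have "l j + 2 * r * \<eta> \<le> l i" .
    moreover have "\<eta> * l i \<le> \<eta> * r" using lK[OF that(1)] eta by simp
    ultimately have "r * \<eta> \<le> norm (x (N i)) - norm (x (N j))"
      using N[of i] N[of j] that by (simp add: algebra_simps)
    also have "\<dots> \<le> norm (x (N i) - x (N j))" by (rule norm_triangle_ineq2)
    finally show ?thesis .
  qed
  show ?thesis
  proof
    show "0 < r" "r \<le> \<rho>" using r n0 by (auto simp: r_def)
    show "norm (x (N j)) \<le> r" if "j < K" for j using N[OF that] lK[OF that] by simp
    show "r / (2 * real K) \<le> norm (x (N i) - x (N j))" if "i < K" "j < K" "i \<noteq> j" for i j
      using sep[of i j] sep[of j i] that by (cases "i < j") (auto simp: \<eta>_def norm_minus_commute)
  qed auto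
qed

section \<open>Number of patterns against density of chosen cells\<close>

text \<open>Here \<open>c * (C * K) ^ e\<close> will bound the number of patterns,
  \<open>(C * K) ^ d\<close> is the number of cells and \<open>t\<close> the number of chosen cells.
  With \<open>t\<close> about \<open>\<epsilon> * (C * K) ^ d\<close> the last power is at most
  \<open>exp (- \<epsilon> * K / 2)\<close>, which beats the polynomial factor.\<close>

lemma grid_parameters:
  fixes C c \<epsilon> :: real
  assumes "C \<ge> 1" "\<epsilon> > 0" "c \<ge> 0"  "d \<ge> 1"
  obtains K t :: nat where "K \<ge> 1" "real t \<le> \<epsilon> * (C * K) ^ d"
    "c * (C * real K) ^ e * (1 - real K / (C * real K) ^ d) ^ t < 1"
proof -
  \<comment> \<open>Rounding \<open>\<epsilon> * P\<close> down to the integer \<open>t\<close> at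
    most halves it, because \<open>\<epsilon> * P \<ge> 1\<close> for the chosen
    \<open>K\<close>.\<close>
  define a where "a = \<epsilon> / 2"
  have a: "a > 0" using assms by (simp add: a_def)
  have "((\<lambda>K. c * (C / a) ^ e * ((a * real K) ^ e / exp (a * real K))) \<longlongrightarrow> c * (C / a) ^ e * 0) sequentially"
    by (intro tendsto_mult tendsto_const filterlim_compose[OF tendsto_power_div_exp_0]
          filterlim_tendsto_pos_mult_at_top[OF tendsto_const a] filterlim_real_sequentially)
  then have "\<forall>\<^sub>F K in sequentially. c * (C / a) ^ e * ((a * real K) ^ e / exp (a * real K)) < 1"
    by (intro order_tendstoD) auto
  moreover have "\<forall>\<^sub>F K in sequentially. K \<ge> nat \<lceil>1 / \<epsilon>\<rceil> + 1"
    by (rule eventually_ge_at_top)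
  ultimately have "\<forall>\<^sub>F K in sequentially. c * (C / a) ^ e * ((a * real K) ^ e / exp (a * real K)) < 1 \<and> K \<ge> nat \<lceil>1 / \<epsilon>\<rceil> + 1"
    by eventually_elim auto
  then obtain K where K: "c * (C / a) ^ e * ((a * real K) ^ e / exp (a * real K)) < 1" "K \<ge> nat \<lceil>1 / \<epsilon>\<rceil> + 1"
    using eventually_happens'[OF sequentially_bot] by blast
  define P where "P = (C * real K) ^ d"
  define t where "t = nat \<lfloor>\<epsilon> * P\<rfloor>"
  have K1: "real K \<ge> 1" using K(2) by linarith
  have eK: "\<epsilon> * real K \<ge> 1"
  proof -
    have "real K \<ge> 1 / \<epsilon>" using K(2) by linarith
    then show ?thesis using assms by (simp add: field_simps)
  qed
  have CK: "C * real K \<ge> real K" using assms K1 by simp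
  have PK: "P \<ge> real K"
  proof -
    have "C * real K \<le> (C * real K) ^ d" using CK K1 assms by (intro self_le_power) linarith+
    then show ?thesis using CK by (simp add: P_def)
  qed
  have "\<epsilon> * real K \<le> \<epsilon> * P" using PK assms by simp
  then have eP: "\<epsilon> * P \<ge> 1" using eK by linarith
  have t1: "real t \<le> \<epsilon> * P" using eP unfolding t_def by linarith
  have "real t \<ge> \<epsilon> * P - 1" "t \<ge> 1" using eP unfolding t_def by linarith+
  then have t2: "real t \<ge> a * P" unfolding a_def by linarith
  have P0: "P > 0" using PK K1 by simp
  have "(1 - real K / P) ^ t \<le> exp (- (real K / P)) ^ t"
    using PK P0 exp_ge_add_one_self[of "- (real K / P)"] by (intro power_mono) (auto simp: field_simps)
  also have "\<dots> = exp (- (real t * (real K / P)))" by (simp add: exp_of_nat_mult[symmetric])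
  also have "\<dots> \<le> exp (- (a * real K))"
  proof -
    have "a * real K = a * P * (real K / P)" using P0 by simp
    also have "\<dots> \<le> real t * (real K / P)" using t2 P0 by (intro mult_right_mono) auto
    finally show ?thesis by simp
  qed
  finally have "c * (C * real K) ^ e * (1 - real K / P) ^ t \<le> c * (C * real K) ^ e * exp (- (a * real K))"
    using assms by (intro mult_left_mono) auto
  also have "\<dots> = c * (C / a) ^ e * ((a * real K) ^ e / exp (a * real K))"
    using a by (simp add: power_mult_distrib power_divide exp_minus field_simps)
  also have "\<dots> < 1" by (rule K(1))
  finally show ?thesis using that[of K t] K1 t1 by (simp add: P_def)
qed

section \<open>The periodic grid for matrices of bounded distortion\<close>

lemma emeasure_lebesgue_cube:
  fixes a :: "real^'d"
  assumes "l \<ge> 0"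
  shows "emeasure lebesgue (box a (a + (\<chi> i. l))) = ennreal (l ^ CARD('d))"
proof -
  let ?b = "a + (\<chi> i. l)"
  have "a \<bullet> i \<le> ?b \<bullet> i" if "i \<in> Basis" for i :: "real^'d"
    using that assms by (auto simp: Basis_vec_def inner_axis)
  then have "emeasure lborel (box a ?b) = (\<Prod>i\<in>Basis. (?b - a) \<bullet> i)"
    by (rule emeasure_lborel_box)
  also have "(\<Prod>i\<in>Basis. (?b - a) \<bullet> i) = (\<Prod>i\<in>(Basis :: (real^'d) set). l)"
    by (intro prod.cong) (auto simp: Basis_vec_def inner_axis)
  also have "\<dots> = l ^ CARD('d)" by simp
  finally show ?thesis by simp
qed

text \<open>The grid has period \<open>1 / Q\<close>, and each period is cut into \<open>N\<close>
  cells per coordinate. The bounds on \<open>Q\<close> make the period comparable to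
  \<open>4 * k * r\<close>, so a copy of the points fits within one period and its cells stay
  distinct modulo \<open>N\<close>. The complement of the cube in the conclusion disposes of copies
  that leave the cube.\<close>

lemma small_open_set_hitting_copies:
  fixes p :: "nat \<Rightarrow> real^'d" and k K Q t :: nat and r :: real
  defines "N \<equiv> 64 * k\<^sup>2 * CARD('d) * K"
  assumes k: "k \<ge> 1" and K: "K \<ge> 1" and r: "r > 0"
    and Q: "4 * k * r * Q \<le> 1" "1 \<le> 8 * k * r * Q"
    and pr: "\<And>j. j < K \<Longrightarrow> norm (p j) \<le> r"
    and sep: "\<And>i j. i < K \<Longrightarrow> j < K \<Longrightarrow> i \<noteq> j \<Longrightarrow> r / (2 * real K) \<le> norm (p i - p j)"
    and t: "(3 * CARD('d)) ^ (CARD('d) * CARD('d)) * real N ^ (CARD('d) * CARD('d) + CARD('d))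
              * (1 - real K / real N ^ CARD('d)) ^ t < 1"
  shows "\<exists>U. open U \<and> emeasure lebesgue U \<le> ennreal (12 ^ CARD('d) * t / real N ^ CARD('d)) \<and>
           (\<forall>(T::real^'d^'d) v. (\<forall>y. norm (T *v y) \<le> k * norm y \<and> norm y \<le> k * norm (T *v y)) \<longrightarrow>
               (\<exists>j<K. T *v p j + v \<in> U \<union> - cbox 0 1))"
proof -
  define d where "d = CARD('d)"
  have d1: "d \<ge> 1" by (simp add: d_def Suc_le_eq)
  have N: "N \<ge> 64" "N \<ge> K"
  proof -
    have "k\<^sup>2 * d * K \<ge> 1" using k K d1 by (simp add: Suc_le_eq)
    then show "N \<ge> 64" by (simp add: N_def d_def)
    have "64 * k\<^sup>2 * d \<ge> 1" using k d1 by (simp add: Suc_le_eq)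
    then have "1 * K \<le> 64 * k\<^sup>2 * d * K" by (intro mult_right_mono) auto
    then show "N \<ge> K" by (simp add: N_def d_def)
  qed
  have Q1: "Q \<ge> 1" using Q(2) by (cases Q) auto
  define s where "s = 1 / (real N * real Q)"
  have s0: "s > 0" using N Q1 by (simp add: s_def)
  \<comment> \<open>The rounding step for matrix entries: small enough that rounding moves each
    coordinate of an image point by at most half a cell, large enough that the number of rounded
    matrices is polynomial in \<open>N\<close>.\<close>
  define h where "h = 2 * real k / (real d * real N)"
  have h0: "h > 0" using N d1 k by (simp add: h_def)

  have hs: "real d * h * r \<le> s / 2"
  proof -
    have "real d * h * r = 2 * k * r / N" using d1 by (simp add: h_def)
    also have "\<dots> = (4 * k * r * Q) * (s / 2)" using Q1 by (simp add: s_def)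
    also have "\<dots> \<le> 1 * (s / 2)" using Q(1) s0 by (intro mult_right_mono) auto
    finally show ?thesis by simp
  qed
  have krs: "2 * k * r \<le> s * (N / 2)"
    using Q Q1 N by (simp add: s_def field_simps)
  \<comment> \<open>The constant in \<open>N\<close> is made for this: after \<open>T\<close>,
    points at distance \<open>r / (2 * K)\<close> differ by at least \<open>4 * s\<close> in some
    coordinate.\<close>
  have sepN: "4 * s * (k * d) \<le> r / (2 * K)"
  proof -
    have NN: "real N = 64 * k\<^sup>2 * d * K" by (simp add: N_def d_def)
    have "8 * k * d * K * s = 1 / (8 * k * Q)"
      unfolding s_def NN using k K d1 Q1 by (simp add: field_simps power2_eq_square)
    also have "\<dots> \<le> r" using Q(2) k Q1 by (simp add: field_simps)
    finally show ?thesis using K by (simp add: field_simps)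
  qed

  \<comment> \<open>\<open>m\<close> stands for the matrix \<open>h m\<close> that approximates \<open>T\<close>; then \<open>c m y\<close> is, up to bounded error,
      the index of the grid cell that contains \<open>T y\<close>.\<close>
  define c where "c m y i = \<lfloor>(\<Sum>j\<in>UNIV. h * of_int (m (i, j)) * y $ j) / s\<rfloor>"
    for m :: "'d \<times> 'd \<Rightarrow> int" and y :: "real^'d" and i :: 'd
  define X where "X = (PiE UNIV (\<lambda>_. {0..<int N}) :: ('d \<Rightarrow> int) set)"
  define M where "M = (PiE UNIV (\<lambda>_. {- int (d * N)..int (d * N)}) :: ('d \<times> 'd \<Rightarrow> int) set)"
  define S where "S m w = (\<lambda>j. \<lambda>i. (c m (p j) i + w i) mod int N) ` {..<K}" for m w
  \<comment> \<open>Pairs whose cells collide modulo \<open>N\<close> are dropped, as the greedy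
    choice needs sets of size \<open>K\<close>. Pairs coming from an admissible \<open>T\<close>
    survive by the injectivity shown below.\<close>
  define F where "F = (\<lambda>(m, w). S m w) ` (M \<times> X) \<inter> {S. card S = K}"

  have cardX: "card X = N ^ d" by (simp add: X_def card_PiE d_def)
  have finX: "finite X" unfolding X_def by (intro finite_PiE) auto
  have finM: "finite M" unfolding M_def by (intro finite_PiE) auto
  have finF: "finite F" unfolding F_def using finX finM by auto
  have cardM: "card M \<le> (3 * d * N) ^ (d * d)"
  proof -
    have "card M = (2 * (d * N) + 1) ^ (d * d)"
      by (simp add: M_def card_PiE d_def nat_add_distrib nat_mult_distrib mult.commute)
    also have "d * N \<ge> 1" using d1 N by (simp add: Suc_le_eq)
    then have "(2 * (d * N) + 1) ^ (d * d) \<le> (3 * d * N) ^ (d * d)" by (intro power_mono) auto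
    finally show ?thesis .
  qed
  have "card F \<le> card (M \<times> X)"
    unfolding F_def using finM finX
    by (meson Int_lower1 card_image_le card_mono finite_SigmaI finite_imageI order_trans)
  also have "\<dots> \<le> (3 * d * N) ^ (d * d) * N ^ d"
    using cardM by (simp add: card_cartesian_product cardX)
  also have "\<dots> = (3 * d) ^ (d * d) * N ^ (d * d + d)"
    by (simp add: power_mult_distrib power_add)
  finally have cardF: "real (card F) \<le> (3 * d) ^ (d * d) * real N ^ (d * d + d)"
    by (metis of_nat_le_iff of_nat_mult of_nat_power)
  have KX: "K \<le> N ^ d"
    using N self_le_power[of N d] d1 by linarith
  have "\<exists>H\<subseteq>X. card H \<le> t \<and> (\<forall>S\<in>F. S \<inter> H \<noteq> {})"
  proof (rule small_hitting_set[where K = K])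
    show "X \<noteq> {}" using cardX N by auto
    have "S m w \<subseteq> X" for m w using N by (auto simp: S_def X_def PiE_def)
    then show "R \<subseteq> X" if "R \<in> F" for R using that by (auto simp only: F_def)
    show "K \<le> card X" using KX by (simp add: cardX)
    have "real (card F) * (1 - real K / real (card X)) ^ t
        \<le> (3 * d) ^ (d * d) * real N ^ (d * d + d) * (1 - real K / real (card X)) ^ t"
      using cardF KX N by (intro mult_right_mono zero_le_power) (auto simp: cardX simp flip: of_nat_power)
    also have "\<dots> < 1" using t by (simp add: cardX d_def)
    finally show "real (card F) * (1 - real K / real (card X)) ^ t < 1" .
  qed (use finX finF in \<open>auto simp: F_def\<close>)
  then obtain H where H: "H \<subseteq> X" "card H \<le> t" "\<And>S. S \<in> F \<Longrightarrow> S \<inter> H \<noteq> {}" by blast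
  have finH: "finite H" using H(1) finX finite_subset by blast

  \<comment> \<open>\<open>G\<close> lists the cells near the unit cube with index in \<open>H\<close> modulo \<open>N\<close>. The rounding error is
      absorbed by enlarging a cell from side \<open>s\<close> to side \<open>4 s\<close>.\<close>
  define Y where "Y = (PiE UNIV (\<lambda>_. {-1..int Q}) :: ('d \<Rightarrow> int) set)"
  define G where "G = (\<lambda>(\<eta>, q). \<lambda>i. int N * q i + \<eta> i) ` (H \<times> Y)"
  define B where "B g = (let a = (\<chi> i. s * (of_int (g i) - 1)) in box a (a + (\<chi> i. 4 * s)))"
    for g :: "'d \<Rightarrow> int"
  define U where "U = (\<Union>g\<in>G. B g)"
  have finY: "finite Y" unfolding Y_def by (intro finite_PiE) auto
  have finG: "finite G" unfolding G_def using finH finY by auto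
  have cardG: "card G \<le> t * (3 * Q) ^ d"
  proof -
    have "card G \<le> card (H \<times> Y)" unfolding G_def using finH finY by (intro card_image_le) auto
    also have "\<dots> = card H * (Q + 2) ^ d"
      by (simp add: card_cartesian_product Y_def card_PiE d_def nat_add_distrib)
    also have "\<dots> \<le> t * (3 * Q) ^ d" using H(2) Q1 by (intro mult_mono power_mono) auto
    finally show ?thesis .
  qed
  have "open U" unfolding U_def B_def Let_def by (intro open_UN) (auto intro: open_box)
  \<comment> \<open>Each of the at most \<open>(3 * Q) ^ d\<close> periods contributes at most
    \<open>t\<close> cubes of side \<open>4 * s\<close>. Since \<open>s = 1 / (N * Q)\<close>, the
    factor \<open>Q\<close> cancels and the bound does not depend on the scale
    \<open>r\<close>.\<close>
  moreover have "emeasure lebesgue U \<le> ennreal (12 ^ d * t / real N ^ d)"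
  proof -
    have "emeasure lebesgue U \<le> (\<Sum>g\<in>G. emeasure lebesgue (B g))"
      unfolding U_def using finG by (intro emeasure_subadditive_finite) (auto simp: B_def Let_def)
    also have "\<dots> = (\<Sum>g\<in>G. ennreal ((4 * s) ^ d))"
      unfolding B_def Let_def d_def using s0 by (intro sum.cong refl emeasure_lebesgue_cube) auto
    also have "\<dots> = ennreal (card G * (4 * s) ^ d)"
      using s0 by (simp add: ennreal_mult ennreal_of_nat_eq_real_of_nat)
    also have "\<dots> \<le> ennreal (real (t * (3 * Q) ^ d) * (4 * s) ^ d)"
      using s0 cardG by (intro ennreal_leI mult_right_mono of_nat_mono) auto
    also have "real (t * (3 * Q) ^ d) * (4 * s) ^ d = t * (3 * Q * (4 * s)) ^ d"
      by (simp only: of_nat_mult of_nat_power power_mult_distrib mult.assoc)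
    also have "3 * Q * (4 * s) = 12 / N" using Q1 by (simp add: s_def)
    also have "t * (12 / N) ^ d = 12 ^ d * t / real N ^ d" by (simp add: power_divide)
    finally show ?thesis .
  qed
  moreover have "\<exists>j<K. T *v p j + v \<in> U \<union> - cbox 0 1"
    if T: "\<forall>y. norm (T *v y) \<le> k * norm y \<and> norm y \<le> k * norm (T *v y)" for T :: "real^'d^'d" and v
  proof -
    define m where "m = (\<lambda>(i, j). \<lfloor>T $ i $ j / h\<rfloor>)"
    define w where "w i = \<lfloor>v $ i / s\<rfloor> mod int N" for i
    \<comment> \<open>The columns of \<open>T\<close> are images of unit vectors; this bound places
      \<open>m\<close> in the finite set \<open>M\<close>.\<close>
    have "\<bar>T $ i $ j\<bar> \<le> k" for i j
    proof -
      have "\<bar>T $ i $ j\<bar> = \<bar>(T *v axis j 1) $ i\<bar>"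
        by (simp add: matrix_vector_mul_component inner_axis)
      also have "\<dots> \<le> norm (T *v axis j 1)" by (rule component_le_norm_cart)
      also have "\<dots> \<le> k" using T[rule_format, of "axis j 1"] by (simp add: norm_axis_1)
      finally show ?thesis .
    qed
    moreover have "real k / h = d * N / 2" using k d1 N by (simp add: h_def)
    ultimately have Th: "\<bar>T $ i $ j / h\<bar> \<le> d * N / 2" for i j
      using h0 by (metis abs_divide abs_of_pos divide_right_mono less_imp_le)
    have dN: "real d * real N \<ge> 2"
    proof -
      have "d * N \<ge> 1 * 2" using d1 N by (intro mult_mono) auto
      then show ?thesis by (metis mult_1 of_nat_le_iff of_nat_mult of_nat_numeral)
    qed
    have "m ij \<in> {- int (d * N)..int (d * N)}" for ij
    proof -
      obtain i j where ij: "ij = (i, j)" by fastforce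
      have "- (d * N / 2) \<le> T $ i $ j / h" "T $ i $ j / h \<le> d * N / 2" using Th[of i j] by linarith+
      then have "- real_of_int (int (d * N)) \<le> T $ i $ j / h" "T $ i $ j / h < real_of_int (int (d * N)) + 1"
        using dN unfolding of_int_of_nat_eq of_int_mult of_nat_mult by linarith+
      then show ?thesis unfolding m_def ij by (simp add: le_floor_iff floor_le_iff)
    qed
    then have mM: "m \<in> M" by (auto simp: M_def)
    have wX: "w \<in> X" using N by (auto simp: X_def w_def)

    \<comment> \<open>Rounding the matrix costs at most \<open>1 / 2\<close> in either direction,
      and the floor in \<open>c\<close> adds an error in \<open>[0, 1)\<close>.\<close>
    have rounding: "- 1 / 2 \<le> (T *v p j) $ i / s - c m (p j) i \<and> (T *v p j) $ i / s - c m (p j) i < 3 / 2"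
      if j: "j < K" for i j
    proof -
      have "\<bar>(T *v p j) $ i - (\<Sum>l\<in>UNIV. h * of_int (m (i, l)) * p j $ l)\<bar>
          = \<bar>\<Sum>l\<in>UNIV. (T $ i $ l - h * of_int (m (i, l))) * p j $ l\<bar>"
        by (simp add: matrix_vector_mult_def sum_subtractf algebra_simps)
      also have "\<dots> \<le> (\<Sum>l\<in>UNIV. \<bar>(T $ i $ l - h * of_int (m (i, l))) * p j $ l\<bar>)" by (rule sum_abs)
      also have "\<dots> \<le> (\<Sum>l\<in>(UNIV :: 'd set). h * r)"
      proof (intro sum_mono)
        fix l
        have "of_int (m (i, l)) \<le> T $ i $ l / h" "T $ i $ l / h < of_int (m (i, l)) + 1"
          by (simp_all add: m_def)
        then have "\<bar>T $ i $ l - h * of_int (m (i, l))\<bar> \<le> h" using h0 by (simp add: field_simps abs_le_iff)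
        moreover have "\<bar>p j $ l\<bar> \<le> r" using component_le_norm_cart[of "p j" l] pr[OF j] by linarith
        ultimately show "\<bar>(T $ i $ l - h * of_int (m (i, l))) * p j $ l\<bar> \<le> h * r"
          unfolding abs_mult using h0 by (intro mult_mono) auto
      qed
      also have "\<dots> = d * h * r" by (simp add: d_def)
      also have "\<dots> \<le> s / 2" by (rule hs)
      finally have "\<bar>(T *v p j) $ i - (\<Sum>l\<in>UNIV. h * of_int (m (i, l)) * p j $ l)\<bar> / s \<le> (s / 2) / s"
        using s0 by (intro divide_right_mono) auto
      then have "\<bar>(T *v p j) $ i / s - (\<Sum>l\<in>UNIV. h * of_int (m (i, l)) * p j $ l) / s\<bar> \<le> 1 / 2"
        using s0 by (simp add: diff_divide_distrib[symmetric])
      then show ?thesis unfolding c_def by linarith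
    qed

    \<comment> \<open>Two image points differ by at least 4 cells in some coordinate and by at most
      \<open>N / 2\<close> cells in each. Rounding changes a difference by at most 2, so in that
      coordinate the indices differ by at least 2 and at most \<open>N / 2 + 2 < N\<close>: they are
      not congruent modulo \<open>N\<close>.\<close>
    have "inj_on (\<lambda>j. \<lambda>i. (c m (p j) i + w i) mod int N) {..<K}"
    proof (rule inj_onI, rule ccontr)
      fix a b assume ab: "a \<in> {..<K}" "b \<in> {..<K}" "a \<noteq> b"
        and eq: "(\<lambda>i. (c m (p a) i + w i) mod int N) = (\<lambda>i. (c m (p b) i + w i) mod int N)"
      define z where "z = T *v (p a - p b)"
      have z: "z $ i = (T *v p a) $ i - (T *v p b) $ i" for i
        by (simp add: z_def matrix_vector_mult_diff_distrib)
      have "norm z \<le> 2 * k * r"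
      proof -
        have "norm z \<le> k * norm (p a - p b)" unfolding z_def using T by blast
        also have "\<dots> \<le> k * (2 * r)"
          using pr[of a] pr[of b] norm_triangle_ineq4[of "p a" "p b"] ab by (intro mult_left_mono) auto
        finally show ?thesis by simp
      qed
      then have up: "\<bar>z $ i\<bar> / s \<le> N / 2" for i
        using component_le_norm_cart[of z i] krs s0 by (simp add: field_simps)
      have "\<exists>i. \<bar>z $ i\<bar> \<ge> 4 * s"
      proof (rule ccontr)
        assume "\<not> ?thesis"
        then have lt: "\<bar>z $ i\<bar> < 4 * s" for i by (simp add: not_le)
        have "r / (2 * K) \<le> norm (p a - p b)" using sep ab by auto
        also have "\<dots> \<le> k * norm z" unfolding z_def using T by blast
        also have "norm z \<le> (\<Sum>i\<in>UNIV. \<bar>z $ i\<bar>)" by (rule norm_le_l1_cart)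
        also have "\<dots> < (\<Sum>i\<in>(UNIV :: 'd set). 4 * s)" using lt by (intro sum_strict_mono) auto
        also have "\<dots> = 4 * s * d" by (simp add: d_def)
        finally have "r / (2 * K) < k * (4 * s * d)" using k by simp
        then show False using sepN by (simp add: algebra_simps)
      qed
      then obtain i where i: "\<bar>z $ i\<bar> \<ge> 4 * s" by blast
      then have lo: "\<bar>z $ i\<bar> / s \<ge> 4" using s0 by (simp add: field_simps)
      define D where "D = c m (p a) i - c m (p b) i"
      have "\<bar>z $ i / s - of_int D\<bar> \<le> 2"
        using rounding[of a i] rounding[of b i] ab
        unfolding z D_def diff_divide_distrib of_int_diff lessThan_iff by linarith
      moreover have "\<bar>z $ i / s\<bar> = \<bar>z $ i\<bar> / s" using s0 by simp
      ultimately have "\<bar>of_int D\<bar> \<ge> (2::real)" "\<bar>of_int D\<bar> \<le> real N / 2 + 2"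
        using lo up[of i] by linarith+
      then have "\<bar>D\<bar> \<ge> 2" "\<bar>D\<bar> < int N" using N by linarith+
      moreover have "int N dvd D"
      proof -
        have "(c m (p a) i + w i) mod int N = (c m (p b) i + w i) mod int N"
          using fun_cong[OF eq, of i] .
        then show ?thesis by (simp add: mod_eq_dvd_iff D_def)
      qed
      ultimately show False using zdvd_imp_le[of "int N" "\<bar>D\<bar>"] by (cases "D = 0") auto
    qed
    then have "card (S m w) = K" by (simp add: S_def card_image)
    then have "S m w \<in> F" using mM wX by (auto simp: F_def)
    then obtain j where j: "j < K" "(\<lambda>i. (c m (p j) i + w i) mod int N) \<in> H"
      using H(3)[of "S m w"] by (auto simp: S_def)
    define y where "y = T *v p j + v"
    define g where "g i = c m (p j) i + \<lfloor>v $ i / s\<rfloor>" for i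
    \<comment> \<open>The floor of \<open>v $ i / s\<close> adds an error in \<open>[0, 1)\<close>
      to that of \<open>rounding\<close>; the sum stays inside the range that \<open>B g\<close>
      allows.\<close>
    have gy: "- 1 < y $ i / s - g i" "y $ i / s - g i < 3" for i
      using rounding[OF j(1), of i]
      unfolding y_def g_def vector_add_component add_divide_distrib of_int_add by linarith+
    have gH: "(\<lambda>i. g i mod int N) \<in> H"
      using j(2) by (simp add: g_def w_def mod_add_right_eq)
    have "y \<in> U" if yc: "y \<in> cbox 0 1"
    proof -
      \<comment> \<open>For a point of the cube, \<open>g i\<close> can be slightly negative or
        reach \<open>N * Q\<close>; the extra periods \<open>-1\<close> and \<open>Q\<close> in
        \<open>Y\<close> cover these cases.\<close>
      have "g i div int N \<in> {-1..int Q}" for i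
      proof -
        have "0 \<le> y $ i" "y $ i \<le> 1" using yc by (auto simp: mem_box_cart)
        then have "0 \<le> y $ i / s" "y $ i / s \<le> real N * real Q" using s0
          by (auto simp: s_def mult_left_le_one_le mult_le_cancel_right2)
        then have "- 3 < real_of_int (g i)" "real_of_int (g i) < real_of_int (int N * int Q) + 1"
          using gy[of i] by simp_all
        then have g: "- 3 < g i" "g i \<le> int N * int Q" by linarith+
        have "(-1 * int N) div int N \<le> g i div int N" using g N by (intro zdiv_mono1) auto
        moreover have "(-1 * int N) div int N = -1"
          using N by (intro nonzero_mult_div_cancel_right) auto
        ultimately have "-1 \<le> g i div int N" by linarith
        moreover have "g i div int N \<le> (int N * int Q) div int N" using g N by (intro zdiv_mono1) auto
        ultimately show ?thesis using N by simp
      qed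
      then have "(\<lambda>i. g i div int N) \<in> Y" by (auto simp: Y_def)
      then have "g \<in> G" unfolding G_def using gH
        by (intro image_eqI[of _ _ "(\<lambda>i. g i mod int N, \<lambda>i. g i div int N)"]) auto
      moreover have "y \<in> B g"
        using gy s0 by (auto simp: B_def Let_def mem_box_cart field_simps)
      ultimately show ?thesis by (auto simp: U_def)
    qed
    then show ?thesis using j(1) by (auto simp: y_def)
  qed
  ultimately show ?thesis unfolding d_def by blast
qed

section \<open>From bounded distortion to all invertible matrices\<close>

text \<open>Both \<open>T\<close> and its inverse are bounded. An integer bound lets countably many
  distortion classes exhaust the invertible matrices.\<close>

lemma invertible_norm_bounds:
  fixes T :: "real^'d^'d"
  assumes "invertible T"
  obtains k :: nat where "k \<ge> 1"
    "\<And>y :: real^'d. norm (T *v y) \<le> k * norm y" "\<And>y :: real^'d. norm y \<le> k * norm (T *v y)"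
proof -
  obtain T' where T': "T' ** T = mat 1" using assms by (auto simp: invertible_def)
  obtain a where a: "\<And>y. norm (T *v y) \<le> norm y * a"
    using bounded_linear.bounded[OF matrix_vector_mul_bounded_linear[of T]] by blast
  obtain b where b: "\<And>y. norm (T' *v y) \<le> norm y * b"
    using bounded_linear.bounded[OF matrix_vector_mul_bounded_linear[of T']] by blast
  obtain k :: nat where k: "max 1 (max a b) \<le> k" using real_arch_simple by blast
  show ?thesis
  proof
    show "k \<ge> 1" using k by simp
    fix y :: "real^'d"
    have "norm y * a \<le> norm y * k" using k by (intro mult_left_mono) auto
    then show "norm (T *v y) \<le> k * norm y" using a[of y] by (simp add: mult.commute)
    have "T' *v (T *v y) = y" by (simp add: matrix_vector_mul_assoc T')
    then have "norm y \<le> norm (T *v y) * b" using b[of "T *v y"] by simp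
    also have "\<dots> \<le> norm (T *v y) * k" using k by (intro mult_left_mono) auto
    finally show "norm y \<le> k * norm (T *v y)" by (simp add: mult.commute)
  qed
qed

text \<open>The order of choices matters: \<open>K\<close> and \<open>t\<close> come from
  \<open>\<epsilon>\<close> and \<open>k\<close> alone, then the scale \<open>r\<close> is found in
  the sequence, and \<open>Q\<close> is fitted to \<open>r\<close>.\<close>

lemma small_open_set_hitting_copies_of_sequence:
  fixes x :: "nat \<Rightarrow> real^'d" and k :: nat
  assumes nz: "\<And>n. x n \<noteq> 0"
    and lim0: "(\<lambda>n. norm (x n)) \<longlonglongrightarrow> 0"
    and ratio: "(\<lambda>n. norm (x (Suc n)) / norm (x n)) \<longlonglongrightarrow> 1"
    and eps: "\<epsilon> > 0" and k: "k \<ge> 1"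
  shows "\<exists>U. open U \<and> emeasure lebesgue U \<le> ennreal \<epsilon> \<and>
           (\<forall>(T::real^'d^'d) v. (\<forall>y. norm (T *v y) \<le> k * norm y \<and> norm y \<le> k * norm (T *v y)) \<longrightarrow>
               (\<exists>n. T *v x n + v \<in> U \<union> - cbox 0 1))"
proof -
  define d where "d = CARD('d)"
  have d1: "d \<ge> 1" by (simp add: d_def Suc_le_eq)
  define C where "C = 64 * k\<^sup>2 * d"
  have C1: "C \<ge> 1" using k d1 by (simp add: C_def Suc_le_eq)
  \<comment> \<open>Dividing \<open>\<epsilon>\<close> by \<open>12 ^ d\<close> pays for the
    enlarged cells and the extra periods.\<close>
  obtain K t :: nat where K: "K \<ge> 1" and t: "real t \<le> \<epsilon> / 12 ^ d * (real C * K) ^ d"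
    and small: "(3 * d) ^ (d * d) * (real C * real K) ^ (d * d + d)
                  * (1 - real K / (real C * real K) ^ d) ^ t < 1"
    by (rule grid_parameters[of "real C" "\<epsilon> / 12 ^ d" "(3 * d) ^ (d * d)" d "d * d + d"])
       (use C1 eps d1 in auto)
  obtain r p where r: "0 < r" "r \<le> 1 / (4 * real k)" and p: "\<And>j. j < K \<Longrightarrow> p j \<in> range x"
    "\<And>j. j < K \<Longrightarrow> norm (p j) \<le> r"
    "\<And>i j. i < K \<Longrightarrow> j < K \<Longrightarrow> i \<noteq> j \<Longrightarrow> r / (2 * real K) \<le> norm (p i - p j)"
    by (rule separated_norms[OF nz lim0 ratio K, of "1 / (4 * real k)"]) (use k in auto)
  \<comment> \<open>As \<open>u \<le> 1\<close>, rounding \<open>1 / u\<close> down to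
    \<open>Q\<close> loses at most a factor 2, which gives both bounds on \<open>Q\<close>.\<close>
  define u where "u = 4 * real k * r"
  have u: "0 < u" "u \<le> 1" using r k by (auto simp: u_def field_simps)
  define Q where "Q = nat \<lfloor>1 / u\<rfloor>"
  have u1: "1 / u \<ge> 1" using u by (simp add: field_simps)
  then have Qu: "real Q \<le> 1 / u" "real Q > 1 / u - 1" "Q \<ge> 1" unfolding Q_def by linarith+
  then have "2 * real Q \<ge> 1 / u" by linarith
  with Qu u have Q: "4 * k * r * Q \<le> 1" "1 \<le> 8 * k * r * Q"
    by (simp_all add: u_def field_simps)
  have CK: "real (64 * k\<^sup>2 * CARD('d) * K) = real C * real K" by (simp add: C_def d_def)
  obtain U where U: "open U" "emeasure lebesgue U \<le> ennreal (12 ^ d * t / (real C * real K) ^ d)"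
    "\<And>(T::real^'d^'d) v. (\<forall>y. norm (T *v y) \<le> k * norm y \<and> norm y \<le> k * norm (T *v y)) \<Longrightarrow>
               \<exists>j<K. T *v p j + v \<in> U \<union> - cbox 0 1"
    using small_open_set_hitting_copies[where p = p and t = t, OF k K r(1) Q p(2,3)] small
    unfolding CK d_def by auto
  have "12 ^ d * t / (real C * real K) ^ d \<le> \<epsilon>"
    using t C1 K by (simp add: field_simps)
  then have "emeasure lebesgue U \<le> ennreal \<epsilon>" using U(2) by (meson ennreal_leI order_trans)
  moreover have "\<exists>n. T *v x n + v \<in> U \<union> - cbox 0 1"
    if "\<forall>y. norm (T *v y) \<le> k * norm y \<and> norm y \<le> k * norm (T *v y)" for T :: "real^'d^'d" and v
    using U(3)[OF that, of v] p(1) by (metis imageE)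
  ultimately show ?thesis using U(1) by blast
qed

theorem theorem1p1:
  fixes x :: "nat \<Rightarrow> real^'d" and A :: "(real^'d) set"
  assumes "A = range x"
    and "\<And>n. x n \<noteq> 0"
    and "(\<lambda>n. norm (x n)) \<longlonglongrightarrow> 0"
    and "(\<lambda>n. norm (x (Suc n)) / norm (x n)) \<longlonglongrightarrow> 1"
  shows "\<exists>E. closed E \<and> E \<subseteq> cbox 0 1 \<and> emeasure lebesgue E > 0 \<and>
             contains_no_affine_copies E A"
proof -
  \<comment> \<open>\<open>U k\<close> handles distortion at most \<open>Suc k\<close>; the measure
    bounds sum to \<open>1 / 2\<close>, less than the measure of the cube.\<close>
  have "\<exists>U. open U \<and> emeasure lebesgue U \<le> ennreal ((1 / 2) ^ (k + 2)) \<and>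
           (\<forall>(T::real^'d^'d) v. (\<forall>y. norm (T *v y) \<le> Suc k * norm y \<and> norm y \<le> Suc k * norm (T *v y)) \<longrightarrow>
               (\<exists>n. T *v x n + v \<in> U \<union> - cbox 0 1))" for k
    using small_open_set_hitting_copies_of_sequence[OF assms(2-4), of "(1 / 2) ^ (k + 2)" "Suc k"]
    by simp
  then obtain U where U: "\<And>k. open (U k)" "\<And>k. emeasure lebesgue (U k) \<le> ennreal ((1 / 2) ^ (k + 2))"
    "\<And>k (T::real^'d^'d) v. (\<forall>y. norm (T *v y) \<le> Suc k * norm y \<and> norm y \<le> Suc k * norm (T *v y)) \<Longrightarrow>
               \<exists>n. T *v x n + v \<in> U k \<union> - cbox 0 1"
    by metis
  define V where "V = (\<Union>k. U k)"
  define E where "E = cbox 0 1 - V"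
  have V: "open V" using U(1) by (auto simp: V_def)
  have "emeasure lebesgue V \<le> (\<Sum>k. emeasure lebesgue (U k))"
    unfolding V_def using U(1) by (intro emeasure_subadditive_countably) auto
  also have "\<dots> \<le> (\<Sum>k. ennreal ((1 / 2) ^ (k + 2)))" by (intro suminf_le U(2)) auto
  also have "\<dots> = ennreal (1 / 2)"
  proof -
    have "(\<lambda>k. (1 / 2 :: real) ^ (k + 2)) sums (1 / 2)"
      using sums_mult2[OF geometric_sums[of "1 / 2 :: real"], of "1 / 4"] by (simp add: power_add)
    then show ?thesis by (intro suminf_ennreal_eq) auto
  qed
  also have "\<dots> < 1" by (subst ennreal_1[symmetric], subst ennreal_less_iff) auto
  finally have Vm: "emeasure lebesgue V < 1" .
  have cube: "emeasure lebesgue (cbox 0 (1 :: real^'d)) = 1"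
  proof -
    have "(\<Prod>i\<in>(Basis :: (real^'d) set). 1 \<bullet> i) = 1"
      by (intro prod.neutral) (auto simp: Basis_vec_def inner_axis)
    moreover have "\<forall>i\<in>(Basis :: (real^'d) set). 0 \<le> 1 \<bullet> i"
      by (auto simp: Basis_vec_def inner_axis)
    ultimately show ?thesis by (simp add: emeasure_lborel_cbox_eq)
  qed
  have "1 \<le> emeasure lebesgue (E \<union> V)"
    unfolding cube[symmetric] using V by (intro emeasure_mono) (auto simp: E_def)
  also have "\<dots> \<le> emeasure lebesgue E + emeasure lebesgue V"
    using V by (intro emeasure_subadditive) (auto simp: E_def)
  finally have "emeasure lebesgue E > 0" using Vm by (cases "emeasure lebesgue E = 0") (auto simp: zero_less_iff_neq_zero)
  moreover have "closed E" unfolding E_def using V by (intro closed_Diff) auto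
  moreover have "contains_no_affine_copies E A"
    unfolding contains_no_affine_copies_iff
  proof (intro allI impI)
    fix T :: "real^'d^'d" and v assume "invertible T"
    then obtain k :: nat where k: "k \<ge> 1" "\<And>y. norm (T *v y) \<le> k * norm y" "\<And>y. norm y \<le> k * norm (T *v y)"
      by (rule invertible_norm_bounds) blast
    \<comment> \<open>The index is \<open>k - 1\<close> because \<open>U\<close> is indexed from
      \<open>0\<close>. The point found lies in \<open>V\<close> or outside the cube, so not in
      \<open>E\<close>.\<close>
    then obtain n where "T *v x n + v \<in> U (k - 1) \<union> - cbox 0 1"
      using U(3)[of T "k - 1" v] by auto
    then show "\<not> (\<lambda>a. T *v a + v) ` A \<subseteq> E"
      by (auto simp: assms(1) E_def V_def)
  qed
  ultimately show ?thesis by (intro exI[of _ E]) (auto simp: E_def)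
qed

end
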